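(* Let $Z\sim\mathrm{Beta}(\alpha,\beta)$ with $\alpha,\beta\ge1$. (Upper bounds) There exists a universal constant $c>0$ (independent of $\alpha,\beta,x$) such that for all $0<x<\frac{\beta}{\alpha+\beta}$, $$\mathbb{P}\left(Z\ge\frac{\alpha}{\alpha+\beta}+x\right)\le\begin{cases}2\exp\left(-c\left(\frac{\beta^2x^2}{\alpha}\wedge\beta x\right)\right),&\text{if }\beta>\alpha;\\2\exp\left(-c\frac{\alpha^2x^2}{\beta}\right),&\text{if }\alpha\ge\beta,\end{cases}$$ and for all $0<x<\frac{\alpha}{\alpha+\beta}$, $$\mathbb{P}\left(Z\le\frac{\alpha}{\alpha+\beta}-x\right)\le\begin{cases}2\exp\left(-c\left(\frac{\alpha^2x^2}{\beta}\wedge\alpha x\right)\right),&\text{if }\alpha>\beta;\\2\exp\left(-c\frac{\beta^2x^2}{\alpha}\right),&\text{if }\beta\ge\alpha.\end{cases}$$ (Lower bounds) There exists a universal constant $c>0$, and for every $\eta>1$ a constant $C_\eta>0$ depending only on $\eta$, such that for all $0<x\le\frac{\beta}{\eta(\alpha+\beta)}$, $$\mathbb{P}\left(Z\ge\frac{\alpha}{\alpha+\beta}+x\right)\ge\begin{cases}c\exp\left(-C_\eta\left(\frac{\beta^2x^2}{\alpha}\wedge\beta x\right)\right),&\text{if }\beta>\alpha;\\c\exp\left(-C_\eta\frac{\alpha^2x^2}{\beta}\right),&\text{if }\alpha\ge\beta,\end{cases}$$ and for all $0<x\le\frac{\alpha}{\eta(\alpha+\beta)}$, $$\mathbb{P}\left(Z\le\frac{\alpha}{\alpha+\beta}-x\right)\ge\begin{cases}c\exp\left(-C_\eta\left(\frac{\alpha^2x^2}{\beta}\wedge\alpha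 x\right)\right),&\text{if }\alpha>\beta;\\c\exp\left(-C_\eta\frac{\beta^2x^2}{\alpha}\right),&\text{if }\beta\ge\alpha.\end{cases}$$ Moreover, $\mathbb{P}\left(Z\ge\frac{\alpha}{\alpha+\beta}+x\right)=0$ for all $x>\frac{\beta}{\alpha+\beta}$, and $\mathbb{P}\left(Z\le\frac{\alpha}{\alpha+\beta}-x\right)=0$ for all $x>\frac{\alpha}{\alpha+\beta}$.
   Context: $\mathrm{Beta}(\alpha,\beta)$ is the distribution on $(0,1)$ with density proportional to $z^{\alpha-1}(1-z)^{\beta-1}$. $x\wedge y$ denotes the minimum of $x$ and $y$. The constants $c$ and $C_\eta$ do not depend on $\alpha,\beta,x$. *)

theory Defs
  imports "HOL-Probability.Probability"
begin

text \<open>The normalising constant is the library's Euler Beta function; that the resulting density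
  integrates to 1 is the content of \<open>prob_space_beta_distribution\<close> below.\<close>

definition beta_density :: "real \<Rightarrow> real \<Rightarrow> real \<Rightarrow> real" where
  "beta_density \<alpha> \<beta> z =
     (if 0 < z \<and> z < 1 then z powr (\<alpha> - 1) * (1 - z) powr (\<beta> - 1) / Beta \<alpha> \<beta> else 0)"

definition beta_distribution :: "real \<Rightarrow> real \<Rightarrow> real measure" where
  "beta_distribution \<alpha> \<beta> = density lborel (\<lambda>z. ennreal (beta_density \<alpha> \<beta> z))"

lemma space_beta_distribution [simp]: "space (beta_distribution \<alpha> \<beta>) = UNIV"
  by (simp add: beta_distribution_def)

lemma sets_beta_distribution [simp, measurable_cong]: "sets (beta_distribution \<alpha> \<beta>) = sets borel"
  by (simp add: beta_distribution_def)

lemma borel_measurable_beta_density [measurable]: "beta_density \<alpha> \<beta> \<in> borel_measurable borel"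
  unfolding beta_density_def by measurable

lemma Beta_real_pos:
  fixes \<alpha> \<beta> :: real
  assumes "\<alpha> > 0" "\<beta> > 0"
  shows "Beta \<alpha> \<beta> > 0"
  using assms by (simp add: Beta_def Gamma_real_pos)

lemma beta_density_nonneg:
  assumes "\<alpha> > 0" "\<beta> > 0"
  shows "beta_density \<alpha> \<beta> z \<ge> 0"
  using Beta_real_pos[OF assms] by (simp add: beta_density_def)

lemma prob_space_beta_distribution:
  assumes "\<alpha> > 0" "\<beta> > 0"
  shows "prob_space (beta_distribution \<alpha> \<beta>)"
proof
  have "((\<lambda>z. z powr (\<alpha> - 1) * (1 - z) powr (\<beta> - 1)) has_integral Beta \<alpha> \<beta>) {0..1}"
    using has_integral_Beta_real[OF assms] by simp
  then have "((\<lambda>z. z powr (\<alpha> - 1) * (1 - z) powr (\<beta> - 1) / Beta \<alpha> \<beta>)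
      has_integral Beta \<alpha> \<beta> / Beta \<alpha> \<beta>) {0..1}"
    by (rule has_integral_divide)
  then have "((\<lambda>z. z powr (\<alpha> - 1) * (1 - z) powr (\<beta> - 1) / Beta \<alpha> \<beta>) has_integral 1) {0..1}"
    using Beta_real_pos[OF assms] by simp
  then have "(beta_density \<alpha> \<beta> has_integral 1) {0..1}"
    by (rule has_integral_spike[of "{0,1}", rotated 2]) (auto simp: beta_density_def)
  then have "(beta_density \<alpha> \<beta> has_integral 1) UNIV"
    by (rule has_integral_on_superset) (auto simp: beta_density_def)
  then have "(\<integral>\<^sup>+z. ennreal (beta_density \<alpha> \<beta> z) \<partial>lborel) = ennreal 1"
    by (intro nn_integral_has_integral_lborel) (auto simp: beta_density_nonneg[OF assms])
  then show "emeasure (beta_distribution \<alpha> \<beta>) (space (beta_distribution \<alpha> \<beta>)) = 1"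
    by (simp add: beta_distribution_def emeasure_density)
qed

text \<open>Every random variable with the Beta density, on any probability space, has the tail
  probabilities of \<open>beta_distribution\<close>. Hence bounds with constants that must not depend on
  the underlying space can be stated for the law itself.\<close>

lemma distributed_beta_prob:
  assumes Z: "distributed M lborel Z (\<lambda>z. ennreal (beta_density \<alpha> \<beta> z))"
  shows "\<P>(\<omega> in M. Z \<omega> \<ge> t) = \<P>(z in beta_distribution \<alpha> \<beta>. z \<ge> t)"
    and "\<P>(\<omega> in M. Z \<omega> \<le> t) = \<P>(z in beta_distribution \<alpha> \<beta>. z \<le> t)"
proof -
  have meas: "Z \<in> measurable M lborel"
    using Z by (simp add: distributed_def)
  have law: "beta_distribution \<alpha> \<beta> = distr M lborel Z"
    using Z by (simp add: distributed_def beta_distribution_def)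
  have *: "\<P>(\<omega> in M. Z \<omega> \<in> A) = \<P>(z in beta_distribution \<alpha> \<beta>. z \<in> A)"
    if "A \<in> sets lborel" for A
    using that measure_distr[OF meas that] by (simp add: law vimage_def Int_def conj_commute)
  show "\<P>(\<omega> in M. Z \<omega> \<ge> t) = \<P>(z in beta_distribution \<alpha> \<beta>. z \<ge> t)"
    using *[of "{t..}"] by simp
  show "\<P>(\<omega> in M. Z \<omega> \<le> t) = \<P>(z in beta_distribution \<alpha> \<beta>. z \<le> t)"
    using *[of "{..t}"] by simp
qed

end

theory Submission
  imports Defs
begin

text \<open>
  Write \<open>s = \<alpha> + \<beta>\<close>, let \<open>m = \<alpha> / s\<close> be the mean, and put \<open>h(z) = z\<^sup>\<alpha> (1 - z)\<^sup>\<beta>\<close> and \<open>B = Beta \<alpha> \<beta>\<close>. The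
  density is \<open>h(z) / (B z (1 - z))\<close>, and everything rests on the identity that \<open>h'\<close> is the density
  times \<open>- B (s z - \<alpha>)\<close>. As \<open>Z \<mapsto> 1 - Z\<close> exchanges \<open>\<alpha>\<close> and \<open>\<beta>\<close>, only upper tails need to be
  considered.

  Upper bound. Integrating \<open>h'\<close> over \<open>[t, 1]\<close> gives \<open>(s t - \<alpha>) P(Z \<ge> t) \<le> h(t) / B\<close>
  (\<open>weighted_upper_tail_le_kernel\<close>). This makes \<open>P(Z \<ge> t) / h(t)\<close> nonincreasing for \<open>t \<ge> m\<close>, and so
  \<open>P(Z \<ge> t) \<le> h(t) / h(m)\<close> (\<open>beta_upper_tail_le_kernel_ratio\<close>). The logarithmic derivative
  \<open>- s (z - m) / (z (1 - z))\<close> of \<open>h\<close> shows that \<open>ln h(m) - ln h(m + x)\<close> is at least half of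
  \<open>s x\<^sup>2 / ((1 - m) (m + x))\<close>, the function \<open>beta_rate\<close>, which is equivalent to the exponent in the
  statement up to constant factors.

  Lower bound. The same logarithmic derivative bounds \<open>ln h(m) - ln h(v)\<close> from above by a multiple of
  \<open>beta_rate\<close> as long as \<open>1 - v\<close> is not small compared with \<open>1 - m\<close>. The size of the normalising
  constant is needed as well: applying \<open>weighted_upper_tail_le_kernel\<close> to both tails at one standard
  deviation \<open>\<sigma>\<close> and bounding the density trivially in between shows that \<open>B\<close> is at most a
  constant times \<open>h(m) / (s \<sigma>)\<close> (\<open>beta_normaliser_le\<close>). It then suffices to integrate the density over
  an interval that starts at \<open>m + x\<close> and has length comparable to \<open>x + \<sigma>\<close>
  (\<open>beta_upper_tail_ge\<close>). The resulting prefactor degenerates as \<open>\<eta>\<close> tends to \<open>1\<close>, but only for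
  \<open>x\<close> comparable to \<open>1 - m\<close>; there the exponent is bounded below, so the loss can be moved
  into the constant \<open>C\<close> (\<open>beta_upper_tail_lower_bound\<close>).
\<close>

section \<open>The kernel and the density\<close>

text \<open>The exponents are \<open>\<alpha>\<close> and \<open>\<beta>\<close>, not \<open>\<alpha> - 1\<close> and \<open>\<beta> - 1\<close>: with this choice the
  maximum of the kernel is at the mean \<open>\<alpha> / (\<alpha> + \<beta>)\<close> of the distribution, and the kernel vanishes
  at both ends of the unit interval for all positive parameters.\<close>
definition beta_kernel :: "real \<Rightarrow> real \<Rightarrow> real \<Rightarrow> real" where
  "beta_kernel \<alpha> \<beta> z = z powr \<alpha> * (1 - z) powr \<beta>"

lemma beta_kernel_nonneg: "beta_kernel \<alpha> \<beta> z \<ge> 0"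
  by (simp add: beta_kernel_def)

lemma beta_kernel_pos: "0 < z \<Longrightarrow> z < 1 \<Longrightarrow> beta_kernel \<alpha> \<beta> z > 0"
  by (simp add: beta_kernel_def)

lemma beta_kernel_reflect: "beta_kernel \<beta> \<alpha> (1 - z) = beta_kernel \<alpha> \<beta> z"
  by (simp add: beta_kernel_def mult.commute)

lemma ln_beta_kernel:
  "0 < z \<Longrightarrow> z < 1 \<Longrightarrow> ln (beta_kernel \<alpha> \<beta> z) = \<alpha> * ln z + \<beta> * ln (1 - z)"
  by (simp add: beta_kernel_def ln_mult ln_powr)

lemma beta_density_eq_kernel:
  assumes "0 < z" "z < 1"
  shows "beta_density \<alpha> \<beta> z = beta_kernel \<alpha> \<beta> z / (z * (1 - z) * Beta \<alpha> \<beta>)"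
  using assms by (simp add: beta_density_def beta_kernel_def powr_diff)

lemma beta_density_reflect: "beta_density \<beta> \<alpha> (1 - z) = beta_density \<alpha> \<beta> z"
  by (auto simp: beta_density_def Beta_commute[of \<beta> \<alpha>] mult.commute)

lemma continuous_on_beta_density:
  assumes "0 < a" "b < 1" "\<alpha> > 0" "\<beta> > 0"
  shows "continuous_on {a..b} (beta_density \<alpha> \<beta>)"
proof -
  have "continuous_on {a..b} (\<lambda>z. z powr (\<alpha> - 1) * (1 - z) powr (\<beta> - 1) / Beta \<alpha> \<beta>)"
    using assms Beta_real_pos[of \<alpha> \<beta>] by (intro continuous_intros) auto
  then show ?thesis
    by (rule continuous_on_eq) (use assms in \<open>auto simp: beta_density_def\<close>)
qed

text \<open>Since the derivative of the kernel is the density times a linear function, integrals of the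
  density weighted by the distance from the mean are explicit.\<close>
lemma beta_kernel_has_derivative:
  assumes "0 < z" "z < 1" "\<alpha> > 0" "\<beta> > 0"
  shows "(beta_kernel \<alpha> \<beta> has_real_derivative
           - (((\<alpha> + \<beta>) * z - \<alpha>) * (Beta \<alpha> \<beta> * beta_density \<alpha> \<beta> z))) (at z)"
proof -
  have "(beta_kernel \<alpha> \<beta> has_real_derivative
       \<alpha> * z powr (\<alpha> - 1) * (1 - z) powr \<beta> + z powr \<alpha> * (- (\<beta> * (1 - z) powr (\<beta> - 1)))) (at z)"
    unfolding beta_kernel_def[abs_def] using assms
    by (auto intro!: derivative_eq_intros simp: algebra_simps powr_diff)
  moreover have "\<alpha> * z powr (\<alpha> - 1) * (1 - z) powr \<beta> + z powr \<alpha> * (- (\<beta> * (1 - z) powr (\<beta> - 1)))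
      = - (((\<alpha> + \<beta>) * z - \<alpha>) * (Beta \<alpha> \<beta> * beta_density \<alpha> \<beta> z))"
    using assms Beta_real_pos[of \<alpha> \<beta>] by (simp add: beta_density_def powr_diff field_simps)
  ultimately show ?thesis by simp
qed

section \<open>Tail probabilities as integrals\<close>

lemma has_integral_beta_density:
  assumes "\<alpha> > 0" "\<beta> > 0" "A \<in> sets borel"
  shows "(beta_density \<alpha> \<beta> has_integral measure (beta_distribution \<alpha> \<beta>) A) A"
proof -
  interpret prob_space "beta_distribution \<alpha> \<beta>"
    by (rule prob_space_beta_distribution[OF assms(1,2)])
  have nn: "AE z in lborel. 0 \<le> beta_density \<alpha> \<beta> z"
    using beta_density_nonneg[OF assms(1,2)] by simp
  have "integrable (beta_distribution \<alpha> \<beta>) (indicator A :: real \<Rightarrow> real)"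
    using assms by (intro integrable_real_indicator) (auto simp: less_top[symmetric])
  then have int: "integrable lborel (\<lambda>z. beta_density \<alpha> \<beta> z * indicator A z)"
    using nn assms unfolding beta_distribution_def
    by (subst (asm) integrable_density) auto
  have "measure (beta_distribution \<alpha> \<beta>) A = (LINT z|beta_distribution \<alpha> \<beta>. indicator A z)"
    using assms by simp
  also have "\<dots> = (LINT z|lborel. beta_density \<alpha> \<beta> z * indicator A z)"
    using nn assms unfolding beta_distribution_def
    by (subst integral_density) auto
  finally have eq: "measure (beta_distribution \<alpha> \<beta>) A = (LINT z:A|lborel. beta_density \<alpha> \<beta> z)"
    by (simp add: set_lebesgue_integral_def mult.commute)
  have "set_integrable lborel A (beta_density \<alpha> \<beta>)"
    using int by (simp add: set_integrable_def mult.commute)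
  from set_borel_integral_eq_integral[OF this] eq show ?thesis
    by (simp add: has_integral_iff)
qed

lemma beta_upper_tail_eq:
  assumes "\<alpha> > 0" "\<beta> > 0"
  shows "measure (beta_distribution \<alpha> \<beta>) {t..} = measure (beta_distribution \<alpha> \<beta>) {t..1}"
proof -
  have "(\<lambda>z. if z \<in> {t..} then beta_density \<alpha> \<beta> z else 0) =
        (\<lambda>z. if z \<in> {t..1} then beta_density \<alpha> \<beta> z else 0)"
    by (auto simp: beta_density_def)
  then have "(beta_density \<alpha> \<beta> has_integral I) {t..} \<longleftrightarrow> (beta_density \<alpha> \<beta> has_integral I) {t..1}" for I
    unfolding has_integral_restrict_UNIV[of "{t..}" _ I, symmetric]
      has_integral_restrict_UNIV[of "{t..1}" _ I, symmetric] by (simp only:)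
  then have "(beta_density \<alpha> \<beta> has_integral measure (beta_distribution \<alpha> \<beta>) {t..1}) {t..}"
    using has_integral_beta_density[OF assms, of "{t..1}"] by simp
  then show ?thesis
    using has_integral_beta_density[OF assms, of "{t..}"] by (intro has_integral_unique) auto
qed

lemma beta_upper_tail_trivial:
  assumes "\<alpha> > 0" "\<beta> > 0" "t > 1"
  shows "measure (beta_distribution \<alpha> \<beta>) {t..} = 0"
  using assms by (simp add: beta_upper_tail_eq)

text \<open>If \<open>Z\<close> is \<open>Beta(\<alpha>, \<beta>)\<close>, then \<open>1 - Z\<close> is \<open>Beta(\<beta>, \<alpha>)\<close>; every statement on the lower tail is
  obtained in this way from one on the upper tail.\<close>
lemma beta_lower_tail_reflect:
  assumes "\<alpha> > 0" "\<beta> > 0"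
  shows "measure (beta_distribution \<alpha> \<beta>) {..t} = measure (beta_distribution \<beta> \<alpha>) {1 - t..}"
proof -
  have "emeasure (beta_distribution \<beta> \<alpha>) {1 - t..} =
      (\<integral>\<^sup>+z. ennreal (beta_density \<beta> \<alpha> z) * indicator {1 - t..} z \<partial>lborel)"
    by (simp add: beta_distribution_def emeasure_density)
  also have "\<dots> = (\<integral>\<^sup>+z. ennreal (beta_density \<beta> \<alpha> (1 + (-1) * z)) * indicator {1 - t..} (1 + (-1) * z) \<partial>lborel)"
    by (subst nn_integral_real_affine[where c = "-1" and t = 1]) auto
  also have "\<dots> = (\<integral>\<^sup>+z. ennreal (beta_density \<alpha> \<beta> z) * indicator {..t} z \<partial>lborel)"
    by (intro nn_integral_cong) (auto simp: beta_density_reflect indicator_def)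
  also have "\<dots> = emeasure (beta_distribution \<alpha> \<beta>) {..t}"
    by (simp add: beta_distribution_def emeasure_density)
  finally show ?thesis by (simp add: measure_def)
qed

section \<open>Comparison of the tail with the kernel\<close>

text \<open>Integrating the derivative of the kernel over \<open>[t, 1]\<close> gives
  \<open>E[((\<alpha> + \<beta>) Z - \<alpha>); Z \<ge> t] = beta_kernel \<alpha> \<beta> t / Beta \<alpha> \<beta>\<close>, and on this event the linear factor is at
  least its value at \<open>t\<close>. This plays the role of the Mills ratio bound for the normal law.\<close>
lemma weighted_upper_tail_le_kernel:
  assumes ab: "\<alpha> > 0" "\<beta> > 0" and t: "0 \<le> t" "t \<le> 1"
  shows "((\<alpha> + \<beta>) * t - \<alpha>) * measure (beta_distribution \<alpha> \<beta>) {t..} \<le> beta_kernel \<alpha> \<beta> t / Beta \<alpha> \<beta>"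
proof -
  have B: "Beta \<alpha> \<beta> > 0" by (rule Beta_real_pos[OF ab])
  have cont: "continuous_on {t..1} (beta_kernel \<alpha> \<beta>)"
    unfolding beta_kernel_def[abs_def] using ab t
    by (intro continuous_on_mult continuous_on_powr' continuous_on_diff continuous_on_const continuous_on_id) auto
  have "((\<lambda>z. - (((\<alpha> + \<beta>) * z - \<alpha>) * (Beta \<alpha> \<beta> * beta_density \<alpha> \<beta> z)))
      has_integral beta_kernel \<alpha> \<beta> 1 - beta_kernel \<alpha> \<beta> t) {t..1}"
    using t ab cont beta_kernel_has_derivative
    by (intro fundamental_theorem_of_calculus_interior)
       (auto simp: has_real_derivative_iff_has_vector_derivative[symmetric])
  from has_integral_neg[OF has_integral_divide[OF this, of "Beta \<alpha> \<beta>"]]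
  have I: "((\<lambda>z. ((\<alpha> + \<beta>) * z - \<alpha>) * beta_density \<alpha> \<beta> z)
      has_integral beta_kernel \<alpha> \<beta> t / Beta \<alpha> \<beta>) {t..1}"
    using B by (simp add: beta_kernel_def)
  have J: "((\<lambda>z. ((\<alpha> + \<beta>) * t - \<alpha>) * beta_density \<alpha> \<beta> z)
      has_integral ((\<alpha> + \<beta>) * t - \<alpha>) * measure (beta_distribution \<alpha> \<beta>) {t..1}) {t..1}"
    by (intro has_integral_mult_right has_integral_beta_density ab) auto
  show ?thesis
    unfolding beta_upper_tail_eq[OF ab]
    by (rule has_integral_le[OF J I])
       (use ab in \<open>auto intro!: mult_right_mono beta_density_nonneg\<close>)
qed

text \<open>The bound \<open>weighted_upper_tail_le_kernel\<close> says exactly that the quotient of tail probability and kernel is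
  nonincreasing to the right of the mean, so it can be compared with its value at the mean.
  The right-hand side is \<open>exp (- (\<alpha> + \<beta>) KL)\<close>, where \<open>KL\<close> is the relative entropy of the Bernoulli
  law with parameter \<open>\<alpha> / (\<alpha> + \<beta>)\<close> with respect to the one with parameter \<open>t\<close>. It is also what
  Chernoff's method gives when \<open>Z\<close> is written as a quotient of Gamma variables.\<close>
lemma beta_upper_tail_le_kernel_ratio:
  assumes ab: "\<alpha> > 0" "\<beta> > 0" and t: "\<alpha> / (\<alpha> + \<beta>) \<le> t" "t < 1"
  shows "measure (beta_distribution \<alpha> \<beta>) {t..}
      \<le> beta_kernel \<alpha> \<beta> t / beta_kernel \<alpha> \<beta> (\<alpha> / (\<alpha> + \<beta>))"
proof -
  interpret prob_space "beta_distribution \<alpha> \<beta>"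
    by (rule prob_space_beta_distribution[OF ab])
  define m where "m = \<alpha> / (\<alpha> + \<beta>)"
  define F where "F = (\<lambda>y. measure (beta_distribution \<alpha> \<beta>) {y..})"
  have m0: "0 < m" using ab by (simp add: m_def)
  \<comment> \<open>\<open>[a, b]\<close> contains \<open>[m, t]\<close> in its interior and stays inside \<open>(0, 1)\<close>, where the density is
    continuous; at the end points of the unit interval it may jump.\<close>
  define a b where "a = m / 2" and "b = (1 + t) / 2"
  have mt: "m \<le> t" using t by (simp add: m_def)
  have abd: "0 < a" "a < m" "t < b" "b < 1" using m0 t by (auto simp: a_def b_def)
  have dF: "(F has_real_derivative - beta_density \<alpha> \<beta> y) (at y)" if y: "m \<le> y" "y \<le> t" for y
  proof -
    have "((\<lambda>y. integral {a..y} (beta_density \<alpha> \<beta>)) has_real_derivative beta_density \<alpha> \<beta> y)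
        (at y within {a..b})"
      by (rule integral_has_real_derivative[OF continuous_on_beta_density])
         (use ab abd y in auto)
    then have d: "((\<lambda>y. integral {a..y} (beta_density \<alpha> \<beta>)) has_real_derivative beta_density \<alpha> \<beta> y) (at y)"
      using abd y by (subst (asm) at_within_interior) auto
    have dF0: "((\<lambda>y. F a - integral {a..y} (beta_density \<alpha> \<beta>)) has_real_derivative 0 - beta_density \<alpha> \<beta> y) (at y)"
      by (intro derivative_intros d)
    have ev: "F a - integral {a..z} (beta_density \<alpha> \<beta>) = F z" if "z \<in> {a<..<b}" for z
    proof -
      have z: "a \<le> z" "z \<le> b" using that by auto
      have "integral {a..z} (beta_density \<alpha> \<beta>) + integral {z..1} (beta_density \<alpha> \<beta>)
          = integral {a..1} (beta_density \<alpha> \<beta>)"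
        by (rule Henstock_Kurzweil_Integration.integral_combine)
           (use z abd has_integral_beta_density[OF ab, of "{a..1}"] in \<open>auto simp: has_integral_iff\<close>)
      then show ?thesis
        using has_integral_beta_density[OF ab, of "{a..1}"] has_integral_beta_density[OF ab, of "{z..1}"]
        by (simp add: F_def beta_upper_tail_eq[OF ab] has_integral_iff)
    qed
    have "y \<in> {a<..<b}" using y abd by simp
    then have "(F has_real_derivative 0 - beta_density \<alpha> \<beta> y) (at y)"
      by (rule has_field_derivative_transform_within_open[OF dF0 open_greaterThanLessThan]) (rule ev)
    then show ?thesis by simp
  qed
  have "F t / beta_kernel \<alpha> \<beta> t \<le> F m / beta_kernel \<alpha> \<beta> m"
  proof (rule DERIV_nonpos_imp_nonincreasing[OF mt])
    fix y assume y: "m \<le> y" "y \<le> t"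
    have y01: "0 < y" "y < 1" using y m0 t by auto
    let ?h = "beta_kernel \<alpha> \<beta> y" and ?f = "beta_density \<alpha> \<beta> y" and ?B = "Beta \<alpha> \<beta>"
    have h: "?h > 0" using y01 by (rule beta_kernel_pos)
    have B: "?B > 0" by (rule Beta_real_pos[OF ab])
    have "((\<lambda>y. F y / beta_kernel \<alpha> \<beta> y) has_real_derivative
        ((- ?f) * ?h - F y * (- (((\<alpha> + \<beta>) * y - \<alpha>) * (?B * ?f)))) / (?h * ?h)) (at y)"
      by (rule DERIV_divide[OF dF[OF y] beta_kernel_has_derivative]) (use y01 ab h in auto)
    moreover have "((- ?f) * ?h - F y * (- (((\<alpha> + \<beta>) * y - \<alpha>) * (?B * ?f)))) / (?h * ?h) \<le> 0"
    proof -
      have "((\<alpha> + \<beta>) * y - \<alpha>) * F y * ?B \<le> ?h"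
        using weighted_upper_tail_le_kernel[OF ab, of y] y01 B by (simp add: F_def field_simps)
      then have "?f * (((\<alpha> + \<beta>) * y - \<alpha>) * F y * ?B) \<le> ?f * ?h"
        by (rule mult_left_mono) (rule beta_density_nonneg[OF ab])
      then show ?thesis using h by (intro divide_nonpos_pos) (auto simp: algebra_simps)
    qed
    ultimately show "\<exists>d. ((\<lambda>y. F y / beta_kernel \<alpha> \<beta> y) has_real_derivative d) (at y) \<and> d \<le> 0" by blast
  qed
  also have "\<dots> \<le> 1 / beta_kernel \<alpha> \<beta> m"
    by (intro divide_right_mono) (auto simp: F_def beta_kernel_nonneg)
  finally show ?thesis
    using beta_kernel_pos[of t \<alpha> \<beta>] mt m0 t by (simp add: F_def m_def field_simps)
qed

section \<open>Decay of the kernel away from the mean\<close>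

lemma ln_beta_kernel_has_derivative:
  assumes z: "0 < z" "z < 1" and ab: "\<alpha> > 0" "\<beta> > 0"
  shows "((\<lambda>z. \<alpha> * ln z + \<beta> * ln (1 - z)) has_real_derivative
           - ((\<alpha> + \<beta>) * (z - \<alpha> / (\<alpha> + \<beta>)) / (z * (1 - z)))) (at z)"
proof -
  have "((\<lambda>z. \<alpha> * ln z + \<beta> * ln (1 - z)) has_real_derivative (\<alpha> / z - \<beta> / (1 - z))) (at z)"
    using z by - (rule derivative_eq_intros refl | simp)+
  moreover have "(\<alpha> + \<beta>) * (z - \<alpha> / (\<alpha> + \<beta>)) = (\<alpha> + \<beta>) * z - \<alpha>"
    using ab by (simp add: right_diff_distrib)
  moreover have "\<alpha> / z - \<beta> / (1 - z) = - (((\<alpha> + \<beta>) * z - \<alpha>) / (z * (1 - z)))"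
    using z by (simp add: field_simps)
  ultimately show ?thesis by simp
qed

text \<open>The logarithmic derivative of the kernel at \<open>y\<close> is \<open>- (\<alpha> + \<beta>) (y - m) / (y (1 - y))\<close> with
  \<open>m = \<alpha> / (\<alpha> + \<beta>)\<close>. For \<open>m \<le> y \<le> v\<close> the denominator is at most \<open>v (1 - m)\<close>. Keeping \<open>v\<close> here, not
  \<open>m\<close>, is what makes the bound quadratic near the mean and linear far from it.\<close>
lemma beta_kernel_decay:
  assumes ab: "\<alpha> > 0" "\<beta> > 0" and v: "\<alpha> / (\<alpha> + \<beta>) \<le> v" "v < 1"
  shows "beta_kernel \<alpha> \<beta> v \<le> beta_kernel \<alpha> \<beta> (\<alpha> / (\<alpha> + \<beta>))
    * exp (- ((\<alpha> + \<beta>) * (v - \<alpha> / (\<alpha> + \<beta>))\<^sup>2 / (2 * (1 - \<alpha> / (\<alpha> + \<beta>)) * v)))"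
proof -
  define m where "m = \<alpha> / (\<alpha> + \<beta>)"
  have m: "0 < m" "m \<le> v" "m < 1" using ab v by (auto simp: m_def)
  define q where "q = 2 * (1 - m) * v"
  have q: "q > 0" using m by (simp add: q_def)
  define L where "L = (\<lambda>y. \<alpha> * ln y + \<beta> * ln (1 - y))"
  have "L v + (\<alpha> + \<beta>) * (v - m)\<^sup>2 / q \<le> L m + (\<alpha> + \<beta>) * (m - m)\<^sup>2 / q"
  proof (rule DERIV_nonpos_imp_nonincreasing[OF m(2)])
    fix y assume y: "m \<le> y" "y \<le> v"
    have y01: "0 < y" "y < 1" using m v y by auto
    have dL: "(L has_real_derivative - ((\<alpha> + \<beta>) * (y - m) / (y * (1 - y)))) (at y)"
      unfolding L_def m_def by (rule ln_beta_kernel_has_derivative[OF y01 ab])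
    have "((\<lambda>y. L y + (\<alpha> + \<beta>) * (y - m)\<^sup>2 / q) has_real_derivative
        - ((\<alpha> + \<beta>) * (y - m) / (y * (1 - y))) + (\<alpha> + \<beta>) * (2 * (y - m)) / q) (at y)"
      by (rule dL derivative_eq_intros refl | use q in simp)+
    moreover have "(\<alpha> + \<beta>) * (2 * (y - m)) / q = (\<alpha> + \<beta>) * (y - m) / (v * (1 - m))"
      using m by (simp add: q_def field_simps)
    moreover have "(\<alpha> + \<beta>) * (y - m) / (v * (1 - m)) \<le> (\<alpha> + \<beta>) * (y - m) / (y * (1 - y))"
      using y y01 m ab by (intro divide_left_mono mult_mono) auto
    ultimately show "\<exists>d. ((\<lambda>y. L y + (\<alpha> + \<beta>) * (y - m)\<^sup>2 / q) has_real_derivative d) (at y) \<and> d \<le> 0"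
      by (intro exI conjI) (assumption, simp)
  qed
  then have "ln (beta_kernel \<alpha> \<beta> v) \<le> ln (beta_kernel \<alpha> \<beta> m) + (- ((\<alpha> + \<beta>) * (v - m)\<^sup>2 / q))"
    using m v by (simp add: ln_beta_kernel L_def)
  then have "exp (ln (beta_kernel \<alpha> \<beta> v)) \<le> exp (ln (beta_kernel \<alpha> \<beta> m) + (- ((\<alpha> + \<beta>) * (v - m)\<^sup>2 / q)))"
    by simp
  then show ?thesis
    using m v by (subst (asm) exp_add) (simp add: beta_kernel_pos m_def q_def)
qed

lemma beta_kernel_antimono:
  assumes ab: "\<alpha> > 0" "\<beta> > 0" and v: "\<alpha> / (\<alpha> + \<beta>) \<le> y" "y \<le> v" "v < 1"
  shows "beta_kernel \<alpha> \<beta> v \<le> beta_kernel \<alpha> \<beta> y"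
proof (rule DERIV_nonpos_imp_nonincreasing[OF v(2)])
  fix z assume z: "y \<le> z" "z \<le> v"
  have "0 < \<alpha> / (\<alpha> + \<beta>)" using ab by simp
  then have z01: "0 < z" "z < 1" using v z by linarith+
  have "\<alpha> \<le> (\<alpha> + \<beta>) * y" using v ab by (simp add: pos_divide_le_eq mult.commute)
  also have "\<dots> \<le> (\<alpha> + \<beta>) * z" using z ab by (intro mult_left_mono) auto
  finally have "(\<alpha> + \<beta>) * z - \<alpha> \<ge> 0" by simp
  then have "- (((\<alpha> + \<beta>) * z - \<alpha>) * (Beta \<alpha> \<beta> * beta_density \<alpha> \<beta> z)) \<le> 0"
    using beta_density_nonneg[OF ab, of z] Beta_real_pos[OF ab] by simp
  moreover have "(beta_kernel \<alpha> \<beta> has_real_derivative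
      - (((\<alpha> + \<beta>) * z - \<alpha>) * (Beta \<alpha> \<beta> * beta_density \<alpha> \<beta> z))) (at z)"
    by (rule beta_kernel_has_derivative[OF z01 ab])
  ultimately show "\<exists>d. (beta_kernel \<alpha> \<beta> has_real_derivative d) (at z) \<and> d \<le> 0" by blast
qed

text \<open>A converse to the decay estimate: \<open>(y - m) / y\<close> and \<open>1 / (1 - y)\<close> both increase with \<open>y\<close>, so the
  logarithmic derivative is largest in absolute value at the right end of \<open>[m, v]\<close>.\<close>
lemma beta_kernel_lower:
  assumes ab: "\<alpha> > 0" "\<beta> > 0" and v: "\<alpha> / (\<alpha> + \<beta>) \<le> v" "v < 1"
  shows "beta_kernel \<alpha> \<beta> v \<ge> beta_kernel \<alpha> \<beta> (\<alpha> / (\<alpha> + \<beta>))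
    * exp (- ((\<alpha> + \<beta>) * (v - \<alpha> / (\<alpha> + \<beta>))\<^sup>2 / (v * (1 - v))))"
proof (cases "v = \<alpha> / (\<alpha> + \<beta>)")
  case False
  define m where "m = \<alpha> / (\<alpha> + \<beta>)"
  have m: "0 < m" "m < v" using ab v False by (auto simp: m_def)
  define L where "L = (\<lambda>y. \<alpha> * ln y + \<beta> * ln (1 - y))"
  have dL: "(L has_real_derivative - ((\<alpha> + \<beta>) * (y - m) / (y * (1 - y)))) (at y)"
    if "m \<le> y" "y \<le> v" for y
    unfolding L_def m_def by (rule ln_beta_kernel_has_derivative) (use that m v ab in auto)
  obtain y where y: "m < y" "y < v" "L v - L m = (v - m) * - ((\<alpha> + \<beta>) * (y - m) / (y * (1 - y)))"
    using MVT2[OF m(2), of L, OF dL] by blast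
  have y0: "y > 0" using y m by simp
  have frac: "(y - m) / y \<le> (v - m) / v"
    using y m y0 by (simp add: field_simps)
  have "(y - m) / (y * (1 - y)) = (y - m) / y / (1 - y)" by simp
  also have "\<dots> \<le> (v - m) / v / (1 - v)"
    using y m y0 v by (intro frac_le frac divide_nonneg_nonneg) auto
  finally have "(v - m) * (\<alpha> + \<beta>) * ((y - m) / (y * (1 - y))) \<le> (v - m) * (\<alpha> + \<beta>) * ((v - m) / (v * (1 - v)))"
    using y m ab by (intro mult_left_mono) auto
  then have "L m - (\<alpha> + \<beta>) * (v - m)\<^sup>2 / (v * (1 - v)) \<le> L v"
    using y(3) by (simp add: power2_eq_square mult_ac)
  then have "ln (beta_kernel \<alpha> \<beta> m) + (- ((\<alpha> + \<beta>) * (v - m)\<^sup>2 / (v * (1 - v)))) \<le> ln (beta_kernel \<alpha> \<beta> v)"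
    using m v by (simp add: ln_beta_kernel L_def)
  then have "exp (ln (beta_kernel \<alpha> \<beta> m) + (- ((\<alpha> + \<beta>) * (v - m)\<^sup>2 / (v * (1 - v))))) \<le> exp (ln (beta_kernel \<alpha> \<beta> v))"
    by simp
  then show ?thesis
    using m v by (subst (asm) exp_add) (simp add: beta_kernel_pos m_def)
qed simp

section \<open>Upper bound for the tail\<close>

text \<open>With \<open>m = \<alpha> / (\<alpha> + \<beta>)\<close> this is, up to a factor of at most \<open>2\<close>, the minimum of the Gaussian
  exponent \<open>(\<alpha> + \<beta>) x\<^sup>2 / (m (1 - m))\<close> and the exponential one \<open>(\<alpha> + \<beta>) x / (1 - m)\<close>. Having a single
  formula avoids case distinctions in the estimates.\<close>
definition beta_rate :: "real \<Rightarrow> real \<Rightarrow> real \<Rightarrow> real" where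
  "beta_rate \<alpha> \<beta> x = (\<alpha> + \<beta>) * x\<^sup>2 / ((1 - \<alpha> / (\<alpha> + \<beta>)) * (\<alpha> / (\<alpha> + \<beta>) + x))"

lemma beta_upper_tail_le:
  assumes ab: "\<alpha> > 0" "\<beta> > 0" and x: "0 \<le> x" "x < \<beta> / (\<alpha> + \<beta>)"
  shows "measure (beta_distribution \<alpha> \<beta>) {\<alpha> / (\<alpha> + \<beta>) + x..} \<le> exp (- beta_rate \<alpha> \<beta> x / 2)"
proof -
  let ?m = "\<alpha> / (\<alpha> + \<beta>)"
  have m: "0 < ?m" "?m < 1" "?m + \<beta> / (\<alpha> + \<beta>) = 1"
    using ab by (auto simp: add_divide_distrib[symmetric])
  have "measure (beta_distribution \<alpha> \<beta>) {?m + x..} \<le> beta_kernel \<alpha> \<beta> (?m + x) / beta_kernel \<alpha> \<beta> ?m"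
    by (rule beta_upper_tail_le_kernel_ratio[OF ab]) (use x m in auto)
  also have "\<dots> \<le> exp (- beta_rate \<alpha> \<beta> x / 2)"
  proof -
    have eq: "(\<alpha> + \<beta>) * (?m + x - ?m)\<^sup>2 / (2 * (1 - ?m) * (?m + x)) = beta_rate \<alpha> \<beta> x / 2"
      by (simp only: beta_rate_def divide_divide_eq_left add_diff_cancel_left' mult_ac)
    show ?thesis
      using beta_kernel_decay[OF ab, of "?m + x"] x m beta_kernel_pos[OF m(1,2), of \<alpha> \<beta>]
      unfolding eq by (simp add: pos_divide_le_eq mult.commute)
  qed
  finally show ?thesis .
qed

section \<open>The normalising constant\<close>

text \<open>This is half of \<open>sqrt (m (1 - m) / (\<alpha> + \<beta>))\<close> with \<open>m = \<alpha> / (\<alpha> + \<beta>)\<close>, hence comparable to the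
  standard deviation of the distribution. The factor \<open>1 / 2\<close> keeps an interval of this radius around
  the mean away from \<open>0\<close> and \<open>1\<close>.\<close>
definition beta_scale :: "real \<Rightarrow> real \<Rightarrow> real" where
  "beta_scale \<alpha> \<beta> = sqrt (\<alpha> * \<beta> / (\<alpha> + \<beta>) ^ 3) / 2"

lemma beta_scale_commute: "beta_scale \<beta> \<alpha> = beta_scale \<alpha> \<beta>"
  by (simp add: beta_scale_def mult.commute add.commute)

lemma beta_scale_pos: "\<alpha> > 0 \<Longrightarrow> \<beta> > 0 \<Longrightarrow> beta_scale \<alpha> \<beta> > 0"
  by (simp add: beta_scale_def)

lemma beta_scale_square:
  assumes ab: "\<alpha> > 0" "\<beta> > 0"
  shows "4 * (\<alpha> + \<beta>) * (beta_scale \<alpha> \<beta>)\<^sup>2 = \<alpha> / (\<alpha> + \<beta>) * (1 - \<alpha> / (\<alpha> + \<beta>))"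
proof -
  have "1 - \<alpha> / (\<alpha> + \<beta>) = \<beta> / (\<alpha> + \<beta>)" using ab by (simp add: field_simps)
  moreover have "(beta_scale \<alpha> \<beta>)\<^sup>2 = \<alpha> * \<beta> / (\<alpha> + \<beta>) ^ 3 / 4"
    using ab by (simp add: beta_scale_def power_divide)
  moreover have "4 * s * (\<alpha> * \<beta> / s ^ 3 / 4) = \<alpha> / s * (\<beta> / s)" if "s > 0" for s :: real
    using that by (simp add: power3_eq_cube)
  ultimately show ?thesis using ab by (simp only: add_pos_pos)
qed

text \<open>For parameters below \<open>1\<close> the standard deviation can exceed the distance from the mean to the
  ends of the unit interval by an arbitrary factor.\<close>
lemma beta_scale_le:
  assumes ab: "\<alpha> \<ge> 1" "\<beta> \<ge> 1"
  shows "beta_scale \<alpha> \<beta> \<le> \<alpha> / (\<alpha> + \<beta>) / 2"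
proof -
  have "\<beta> \<le> \<alpha> * (\<alpha> + \<beta>)" using ab
    by (smt (verit) mult_le_cancel_right1)
  then have "\<alpha> * \<beta> / (\<alpha> + \<beta>) ^ 3 \<le> \<alpha> * (\<alpha> * (\<alpha> + \<beta>)) / (\<alpha> + \<beta>) ^ 3"
    using ab by (intro divide_right_mono mult_left_mono) auto
  also have "\<dots> = (\<alpha> / (\<alpha> + \<beta>))\<^sup>2"
  proof -
    have "\<alpha> * (\<alpha> * s) / s ^ 3 = (\<alpha> / s)\<^sup>2" if "s > 0" for s
      using that by (simp add: power3_eq_cube power2_eq_square)
    then show ?thesis using ab by simp
  qed
  finally have "\<alpha> * \<beta> / (\<alpha> + \<beta>) ^ 3 \<le> (\<alpha> / (\<alpha> + \<beta>))\<^sup>2" .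
  then have "sqrt (\<alpha> * \<beta> / (\<alpha> + \<beta>) ^ 3) \<le> \<alpha> / (\<alpha> + \<beta>)"
    using ab by (intro real_le_lsqrt) auto
  then show ?thesis
    unfolding beta_scale_def by (rule divide_right_mono) simp
qed

lemma beta_kernel_le_mode:
  assumes ab: "\<alpha> > 0" "\<beta> > 0" and z: "0 < z" "z < 1"
  shows "beta_kernel \<alpha> \<beta> z \<le> beta_kernel \<alpha> \<beta> (\<alpha> / (\<alpha> + \<beta>))"
proof (cases "\<alpha> / (\<alpha> + \<beta>) \<le> z")
  case True
  then show ?thesis using beta_kernel_antimono[OF ab] z by simp
next
  case False
  have m: "1 - \<alpha> / (\<alpha> + \<beta>) = \<beta> / (\<beta> + \<alpha>)" using ab by (simp add: field_simps)
  have "beta_kernel \<beta> \<alpha> (1 - z) \<le> beta_kernel \<beta> \<alpha> (1 - \<alpha> / (\<alpha> + \<beta>))"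
    unfolding m by (rule beta_kernel_antimono) (use False m ab z in auto)
  then show ?thesis by (simp add: beta_kernel_reflect)
qed

text \<open>A bound of Stirling type, up to a constant, for the Beta function. The total mass \<open>1\<close> is
  split at distance \<open>r = beta_scale \<alpha> \<beta>\<close> from the mean. Each of the two tails is controlled by the
  Mills ratio bound, where the linear factor is at least \<open>(\<alpha> + \<beta>) r\<close>. In the middle the kernel is at
  most its maximum and \<open>z (1 - z)\<close> is comparable to its value at the mean.\<close>
lemma beta_normaliser_le:
  assumes ab: "\<alpha> \<ge> 1" "\<beta> \<ge> 1"
  shows "(\<alpha> + \<beta>) * beta_scale \<alpha> \<beta> * Beta \<alpha> \<beta> \<le> 4 * beta_kernel \<alpha> \<beta> (\<alpha> / (\<alpha> + \<beta>))"
proof -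
  have ab0: "\<alpha> > 0" "\<beta> > 0" using ab by auto
  interpret prob_space "beta_distribution \<alpha> \<beta>"
    by (rule prob_space_beta_distribution[OF ab0])
  define m where "m = \<alpha> / (\<alpha> + \<beta>)"
  define s where "s = \<alpha> + \<beta>"
  define r where "r = beta_scale \<alpha> \<beta>"
  define H where "H = beta_kernel \<alpha> \<beta> m / Beta \<alpha> \<beta>"
  have B: "Beta \<alpha> \<beta> > 0" by (rule Beta_real_pos[OF ab0])
  have s: "s > 0" "s * m = \<alpha>" using ab0 by (auto simp: s_def m_def)
  have m': "1 - m = \<beta> / (\<beta> + \<alpha>)" using ab0 by (simp add: field_simps m_def)
  have m: "0 < m" "m < 1" using ab0 by (auto simp: m_def)
  have r: "0 < r" "r \<le> m / 2" "r \<le> (1 - m) / 2"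
    using beta_scale_pos[OF ab0] beta_scale_le[OF ab] beta_scale_le[OF ab(2,1)]
    by (auto simp: r_def m_def m' [unfolded m_def] beta_scale_commute)
  have Hle: "beta_kernel \<alpha> \<beta> z / Beta \<alpha> \<beta> \<le> H" if "0 < z" "z < 1" for z
    unfolding H_def m_def using B by (intro divide_right_mono beta_kernel_le_mode ab0 that) auto
  have up: "s * r * measure (beta_distribution \<alpha> \<beta>) {m + r..} \<le> H"
  proof -
    have "(s * (m + r) - \<alpha>) * measure (beta_distribution \<alpha> \<beta>) {m + r..} \<le> beta_kernel \<alpha> \<beta> (m + r) / Beta \<alpha> \<beta>"
      unfolding s_def by (rule weighted_upper_tail_le_kernel[OF ab0]) (use m r in auto)
    also have "\<dots> \<le> H" by (rule Hle) (use m r in auto)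
    also have "s * (m + r) - \<alpha> = s * r" using s by (simp add: algebra_simps)
    finally show ?thesis .
  qed
  have down: "s * r * measure (beta_distribution \<alpha> \<beta>) {..m - r} \<le> H"
  proof -
    have "(s * (1 - (m - r)) - \<beta>) * measure (beta_distribution \<beta> \<alpha>) {1 - (m - r)..}
        \<le> beta_kernel \<beta> \<alpha> (1 - (m - r)) / Beta \<beta> \<alpha>"
      unfolding s_def add.commute[of \<alpha> \<beta>] by (rule weighted_upper_tail_le_kernel[OF ab0(2,1)]) (use m r in auto)
    also have "\<dots> = beta_kernel \<alpha> \<beta> (m - r) / Beta \<alpha> \<beta>"
      by (simp only: beta_kernel_reflect Beta_commute)
    also have "\<dots> \<le> H" by (rule Hle) (use m r in auto)
    also have "s * (1 - (m - r)) - \<beta> = s * r" using s by (simp add: algebra_simps s_def)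
    finally show ?thesis by (simp add: beta_lower_tail_reflect[OF ab0])
  qed
  have mid: "s * r * measure (beta_distribution \<alpha> \<beta>) {m - r..m + r} \<le> 2 * H"
  proof -
    have "measure (beta_distribution \<alpha> \<beta>) {m - r..m + r} \<le> H / (m / 2 * ((1 - m) / 2)) * (2 * r)"
    proof (rule has_integral_le[OF has_integral_beta_density[OF ab0]])
      show "((\<lambda>_. H / (m / 2 * ((1 - m) / 2))) has_integral H / (m / 2 * ((1 - m) / 2)) * (2 * r)) {m - r..m + r}"
        using has_integral_const_real[of "H / (m / 2 * ((1 - m) / 2))" "m - r" "m + r"] r by (simp add: mult.commute)
      fix z assume "z \<in> {m - r..m + r}"
      then have z: "m / 2 \<le> z" "(1 - m) / 2 \<le> 1 - z" "0 < z" "z < 1" using r m by auto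
      have "beta_density \<alpha> \<beta> z = beta_kernel \<alpha> \<beta> z / Beta \<alpha> \<beta> / (z * (1 - z))"
        using z by (simp add: beta_density_eq_kernel)
      also have "\<dots> \<le> H / (m / 2 * ((1 - m) / 2))"
        using z m B by (intro frac_le mult_mono Hle) (auto simp: H_def beta_kernel_nonneg)
      finally show "beta_density \<alpha> \<beta> z \<le> H / (m / 2 * ((1 - m) / 2))" .
    qed auto
    then have "s * r * measure (beta_distribution \<alpha> \<beta>) {m - r..m + r} \<le> s * r * (H / (m / 2 * ((1 - m) / 2)) * (2 * r))"
      using s r by (intro mult_left_mono) auto
    also have "\<dots> = 2 * H * (4 * s * r\<^sup>2) / (m * (1 - m))"
      by (simp add: power2_eq_square)
    also have "4 * s * r\<^sup>2 = m * (1 - m)"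
      unfolding s_def r_def m_def by (rule beta_scale_square[OF ab0])
    finally show ?thesis using m by simp
  qed
  have "1 = prob UNIV" using prob_space by simp
  also have "UNIV = {..m - r} \<union> ({m - r..m + r} \<union> {m + r..})" by auto
  also have "prob \<dots> \<le> prob {..m - r} + (prob {m - r..m + r} + prob {m + r..})"
    by (intro order_trans[OF measure_Un_le] add_left_mono measure_Un_le) auto
  finally have "s * r * 1 \<le> s * r * (prob {..m - r} + (prob {m - r..m + r} + prob {m + r..}))"
    using s r by (intro mult_left_mono) auto
  also have "\<dots> \<le> 4 * H" using up mid down by (simp add: distrib_left)
  finally show ?thesis
    using B by (simp add: H_def r_def s_def m_def field_simps)
qed

section \<open>Lower bound for the tail\<close>

text \<open>The tail beyond \<open>t = m + x\<close> is bounded below by the mass of \<open>[t, v]\<close>, where the length of this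
  interval is a small multiple of \<open>x + r\<close> with \<open>r = beta_scale \<alpha> \<beta>\<close>. The summand \<open>r\<close> makes the interval
  long enough to carry constant mass when \<open>x\<close> is small. When \<open>x\<close> is large compared with \<open>m\<close>, the
  factor \<open>1 / z\<close> in the density is smaller by order \<open>m / x\<close> than at the mean, and the summand \<open>x\<close>
  compensates for that. The factor \<open>k\<close> keeps \<open>1 - v\<close> at
  least \<open>k (1 - m)\<close>, so that \<open>beta_kernel_lower\<close>, applied at \<open>v\<close>, loses only a factor of
  order \<open>1 / k\<close> in the exponent.\<close>
lemma beta_upper_tail_ge:
  assumes ab: "\<alpha> \<ge> 1" "\<beta> \<ge> 1" and x: "0 \<le> x"
    and k: "0 < k" "k \<le> 1 / 2" "2 * k * (1 - \<alpha> / (\<alpha> + \<beta>)) \<le> 1 - \<alpha> / (\<alpha> + \<beta>) - x"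
  shows "measure (beta_distribution \<alpha> \<beta>) {\<alpha> / (\<alpha> + \<beta>) + x..}
    \<ge> k / 72 * exp (- 1 / (2 * k)) * exp (- (8 / k) * beta_rate \<alpha> \<beta> x)"
proof -
  have ab0: "\<alpha> > 0" "\<beta> > 0" using ab by auto
  interpret prob_space "beta_distribution \<alpha> \<beta>"
    by (rule prob_space_beta_distribution[OF ab0])
  define m where "m = \<alpha> / (\<alpha> + \<beta>)"
  define s where "s = \<alpha> + \<beta>"
  define r where "r = beta_scale \<alpha> \<beta>"
  define t where "t = m + x"
  \<comment> \<open>\<open>x + r\<close> is at most \<open>3 / 2\<close> times \<open>1 - m\<close>, so \<open>w\<close> is at most \<open>k (1 - m)\<close>, half of what
    the assumption on \<open>x\<close> leaves between \<open>t\<close> and \<open>1\<close>.\<close>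
  define w where "w = 2 * k / 3 * (x + r)"
  define v where "v = t + w"
  have B: "Beta \<alpha> \<beta> > 0" by (rule Beta_real_pos[OF ab0])
  have s: "s > 0" using ab0 by (auto simp: s_def)
  have m': "1 - m = \<beta> / (\<beta> + \<alpha>)" using ab0 by (simp add: field_simps m_def)
  have m: "0 < m" "m < 1" using ab0 by (auto simp: m_def)
  have r: "0 < r" "r \<le> m / 2" "r \<le> (1 - m) / 2"
    using beta_scale_pos[OF ab0] beta_scale_le[OF ab] beta_scale_le[OF ab(2,1)]
    by (auto simp: r_def m_def m' [unfolded m_def] beta_scale_commute)
  have rsq: "4 * s * r\<^sup>2 = m * (1 - m)"
    unfolding s_def r_def m_def by (rule beta_scale_square[OF ab0])
  have km: "2 * k * (1 - m) \<le> 1 - m - x" "0 < k * (1 - m)"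
    using k m by (auto simp: m_def)
  have xm: "x \<le> 1 - m" using km by simp
  have w: "0 < w" "w \<le> k * (1 - m)" "w \<le> x + r"
  proof -
    show "0 < w" using k x r by (simp add: w_def)
    have "w = k * (2 / 3 * (x + r))" by (simp add: w_def)
    also have "\<dots> \<le> k * (1 - m)" using xm r k by (intro mult_left_mono) auto
    finally show "w \<le> k * (1 - m)" .
    have "2 * k / 3 * (x + r) \<le> 1 * (x + r)" using k x r by (intro mult_right_mono) auto
    then show "w \<le> x + r" by (simp add: w_def)
  qed
  have v1: "k * (1 - m) \<le> 1 - v" using w km by (simp add: v_def t_def)
  have mv: "m \<le> t" "t < v" "v < 1" using x w v1 km by (auto simp: t_def v_def)
  have v3: "v \<le> 3 * (m + x)" using w r m x by (simp add: v_def t_def)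
  define D where "D = s * (v - m)\<^sup>2 / (v * (1 - v))"
  have D: "D \<le> 1 / (2 * k) + 8 / k * beta_rate \<alpha> \<beta> x"
  proof -
    have "(v - m)\<^sup>2 \<le> (2 * x + r)\<^sup>2"
      using w x mv by (intro power_mono) (auto simp: v_def t_def)
    also have "\<dots> \<le> 8 * x\<^sup>2 + 2 * r\<^sup>2"
      using zero_le_power2[of "2 * x - r"] by (simp add: power2_eq_square algebra_simps)
    finally have "s * (v - m)\<^sup>2 \<le> s * (8 * x\<^sup>2 + 2 * r\<^sup>2)" using s by simp
    then have "D \<le> s * (8 * x\<^sup>2 + 2 * r\<^sup>2) / ((m + x) * (k * (1 - m)))"
      unfolding D_def using k(1) m x km v1 s mv
      by (intro frac_le mult_mono mult_pos_pos) (auto simp: t_def)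
    also have "\<dots> = 4 * s * r\<^sup>2 / (2 * k * (1 - m) * (m + x)) + 8 / k * (s * x\<^sup>2 / ((1 - m) * (m + x)))"
      using m x k by (simp add: divide_simps) (simp add: algebra_simps)
    also have "4 * s * r\<^sup>2 / (2 * k * (1 - m) * (m + x)) \<le> 4 * s * r\<^sup>2 / (2 * k * (1 - m) * m)"
      using m x k s by (intro divide_left_mono mult_left_mono mult_pos_pos) auto
    also have "\<dots> = 1 / (2 * k)" unfolding rsq using m by simp
    finally show ?thesis by (simp add: beta_rate_def m_def s_def)
  qed
  define q where "q = beta_kernel \<alpha> \<beta> v / Beta \<alpha> \<beta> / (v * (1 - t))"
  have q: "s * r / 4 * exp (- D) / (v * (1 - t)) \<le> q"
  proof -
    have "s * r / 4 \<le> beta_kernel \<alpha> \<beta> m / Beta \<alpha> \<beta>"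
      using beta_normaliser_le[OF ab] B by (simp add: s_def r_def m_def field_simps)
    then have "s * r / 4 * exp (- D) \<le> beta_kernel \<alpha> \<beta> m / Beta \<alpha> \<beta> * exp (- D)"
      by (intro mult_right_mono) auto
    also have "\<dots> \<le> beta_kernel \<alpha> \<beta> v / Beta \<alpha> \<beta>"
      using beta_kernel_lower[OF ab0, of v] mv B
      by (simp add: D_def s_def m_def divide_right_mono)
    finally show ?thesis
      unfolding q_def using m mv by (intro divide_right_mono mult_nonneg_nonneg) auto
  qed
  \<comment> \<open>Interval length times density scale. As \<open>r \<le> m\<close>, passing from \<open>r / m\<close> to
    \<open>(x + r) / (m + x)\<close> treats small and large \<open>x\<close> at once.\<close>
  have pref: "k / 72 \<le> s * r / 4 / (v * (1 - t)) * w"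
  proof -
    have quarter: "s * r\<^sup>2 / (m * (1 - m)) = 1 / 4"
      unfolding rsq[symmetric] using s r by simp
    have "k / 72 = k / 18 * (s * r\<^sup>2 / (m * (1 - m)))"
      unfolding quarter by simp
    also have "\<dots> = k * s * r / (18 * (1 - m)) * (r / m)"
      by (simp only: power2_eq_square times_divide_times_eq mult_ac)
    also have "\<dots> \<le> k * s * r / (18 * (1 - m)) * ((x + r) / (m + x))"
    proof (rule mult_left_mono)
      have "r * x \<le> m * x" using r m x by (intro mult_right_mono) auto
      then show "r / m \<le> (x + r) / (m + x)" using m x by (simp add: field_simps)
    qed (use k s r m in auto)
    also have "\<dots> = s * r * w / (4 * (3 * (m + x) * (1 - m)))"
    proof -
      have "k * s * r / (18 * M) * (y / N) = s * r * (2 * k / 3 * y) / (4 * (3 * N * M))"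
        if "M \<noteq> 0" "N \<noteq> 0" for M N y :: real
        using that by (simp add: field_simps)
      then show ?thesis using m x by (simp only: w_def)
    qed
    also have "\<dots> \<le> s * r * w / (4 * (v * (1 - t)))"
      using s r w m mv v3 by (intro divide_left_mono mult_left_mono mult_mono mult_pos_pos) auto
    finally show ?thesis by simp
  qed
  have "k / 72 * exp (- 1 / (2 * k)) * exp (- (8 / k) * beta_rate \<alpha> \<beta> x)
      = k / 72 * exp (- (1 / (2 * k) + 8 / k * beta_rate \<alpha> \<beta> x))"
    by (simp add: exp_add[symmetric] mult.assoc)
  also have "\<dots> \<le> k / 72 * exp (- D)"
    using D k by (intro mult_left_mono) auto
  also have "\<dots> \<le> s * r / 4 / (v * (1 - t)) * w * exp (- D)"
    using pref by (intro mult_right_mono) auto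
  also have "\<dots> \<le> q * w"
    using mult_right_mono[OF q, of w] w by (simp add: mult_ac)
  also have "q * w \<le> measure (beta_distribution \<alpha> \<beta>) {t..v}"
  proof (rule has_integral_le[OF _ has_integral_beta_density[OF ab0]])
    show "((\<lambda>_. q) has_integral q * w) {t..v}"
      using has_integral_const_real[of q t v] mv by (simp add: mult.commute v_def)
    fix z assume z: "z \<in> {t..v}"
    have "q \<le> beta_kernel \<alpha> \<beta> z / Beta \<alpha> \<beta> / (z * (1 - z))"
      unfolding q_def using z mv m B
      by (intro frac_le divide_right_mono mult_mono beta_kernel_antimono ab0 mult_pos_pos)
         (auto simp: m_def beta_kernel_nonneg)
    also have "\<dots> = beta_density \<alpha> \<beta> z"
      using z mv m by (simp add: beta_density_eq_kernel)
    finally show "q \<le> beta_density \<alpha> \<beta> z" .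
  qed auto
  also have "\<dots> \<le> measure (beta_distribution \<alpha> \<beta>) {t..}"
    by (intro finite_measure_mono) auto
  finally show ?thesis by (simp add: t_def m_def)
qed

section \<open>Two forms of the exponent\<close>

text \<open>The exponent in the form with a case distinction between \<open>\<beta> > \<alpha>\<close>, where the
  upper tail is Gaussian only up to \<open>x\<close> of order \<open>\<alpha> / \<beta>\<close>, and \<open>\<beta> \<le> \<alpha>\<close>,
  where the upper tail is Gaussian throughout.\<close>
definition tail_exponent :: "real \<Rightarrow> real \<Rightarrow> real \<Rightarrow> real" where
  "tail_exponent \<alpha> \<beta> x =
     (if \<beta> > \<alpha> then min (\<beta>\<^sup>2 * x\<^sup>2 / \<alpha>) (\<beta> * x) else \<alpha>\<^sup>2 * x\<^sup>2 / \<beta>)"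

lemma beta_rate_eq:
  assumes ab: "\<alpha> > 0" "\<beta> > 0"
  shows "beta_rate \<alpha> \<beta> x = (\<alpha> + \<beta>) ^ 3 * x\<^sup>2 / (\<beta> * (\<alpha> + (\<alpha> + \<beta>) * x))"
proof -
  define s where "s = \<alpha> + \<beta>"
  have s: "s > 0" using ab by (simp add: s_def)
  have "(1 - \<alpha> / s) * (\<alpha> / s + x) = \<beta> * (\<alpha> + s * x) / s\<^sup>2"
    using s by (simp add: s_def field_simps power2_eq_square)
  moreover have "s * x\<^sup>2 / (\<beta> * (\<alpha> + s * x) / s\<^sup>2) = s ^ 3 * x\<^sup>2 / (\<beta> * (\<alpha> + s * x))"
    by (simp add: power3_eq_cube power2_eq_square mult_ac)
  ultimately show ?thesis by (simp add: beta_rate_def s_def)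
qed

text \<open>In the denominator \<open>\<beta> (\<alpha> + (\<alpha> + \<beta>) x)\<close> either summand may be dropped, and \<open>\<alpha> + \<beta>\<close> is at most
  twice the larger parameter. Of the resulting factors \<open>2\<^sup>3\<close> and \<open>2\<^sup>2\<close>, the first is the constant.\<close>
lemma beta_rate_le_tail_exponent:
  assumes ab: "\<alpha> > 0" "\<beta> > 0" and x: "0 < x"
  shows "beta_rate \<alpha> \<beta> x \<le> 8 * tail_exponent \<alpha> \<beta> x"
proof -
  define s where "s = \<alpha> + \<beta>"
  have s: "s > 0" using ab by (simp add: s_def)
  have R: "beta_rate \<alpha> \<beta> x = s ^ 3 * x\<^sup>2 / (\<beta> * (\<alpha> + s * x))"
    unfolding s_def by (rule beta_rate_eq[OF ab])
  have R1: "beta_rate \<alpha> \<beta> x \<le> s ^ 3 * x\<^sup>2 / (\<beta> * \<alpha>)"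
    unfolding R using ab s x
    by (intro divide_left_mono mult_left_mono mult_pos_pos add_pos_pos mult_nonneg_nonneg) auto
  have "beta_rate \<alpha> \<beta> x \<le> s ^ 3 * x\<^sup>2 / (\<beta> * (s * x))"
    unfolding R using ab s x
    by (intro divide_left_mono mult_left_mono mult_pos_pos add_pos_pos mult_nonneg_nonneg) auto
  also have "\<dots> = s\<^sup>2 * x / \<beta>" using s x by (simp add: power3_eq_cube power2_eq_square)
  finally have R2: "beta_rate \<alpha> \<beta> x \<le> s\<^sup>2 * x / \<beta>" .
  show ?thesis
  proof (cases "\<beta> > \<alpha>")
    case True
    have le: "s \<le> 2 * \<beta>" using True by (simp add: s_def)
    have "s ^ 3 * x\<^sup>2 / (\<beta> * \<alpha>) \<le> (2 * \<beta>) ^ 3 * x\<^sup>2 / (\<beta> * \<alpha>)"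
      using ab s by (intro divide_right_mono mult_right_mono power_mono le) auto
    moreover have "s\<^sup>2 * x / \<beta> \<le> (2 * \<beta>)\<^sup>2 * x / \<beta>"
      using ab x s by (intro divide_right_mono mult_right_mono power_mono le) auto
    moreover have "(2 * \<beta>) ^ 3 * x\<^sup>2 / (\<beta> * \<alpha>) = 8 * (\<beta>\<^sup>2 * x\<^sup>2 / \<alpha>)" "(2 * \<beta>)\<^sup>2 * x / \<beta> = 4 * (\<beta> * x)"
      using ab by (auto simp: power3_eq_cube power2_eq_square)
    moreover have "\<beta> * x \<ge> 0" using ab x by simp
    ultimately show ?thesis using R1 R2 True by (auto simp: tail_exponent_def min_def)
  next
    case False
    have le: "s \<le> 2 * \<alpha>" using False by (simp add: s_def)
    have "s ^ 3 * x\<^sup>2 / (\<beta> * \<alpha>) \<le> (2 * \<alpha>) ^ 3 * x\<^sup>2 / (\<beta> * \<alpha>)"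
      using ab s by (intro divide_right_mono mult_right_mono power_mono le) auto
    moreover have "(2 * \<alpha>) ^ 3 * x\<^sup>2 / (\<beta> * \<alpha>) = 8 * (\<alpha>\<^sup>2 * x\<^sup>2 / \<beta>)"
      using ab by (auto simp: power3_eq_cube power2_eq_square)
    ultimately show ?thesis using R1 False by (auto simp: tail_exponent_def)
  qed
qed

text \<open>Conversely, a sum is at most twice its larger summand. When \<open>\<beta> \<le> \<alpha>\<close>, the sum
  \<open>\<alpha> + (\<alpha> + \<beta>) x\<close> is at most \<open>\<alpha> + \<beta>\<close> on the range of admissible \<open>x\<close>.\<close>
lemma tail_exponent_le_beta_rate:
  assumes ab: "\<alpha> > 0" "\<beta> > 0" and x: "0 < x" "x \<le> \<beta> / (\<alpha> + \<beta>)"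
  shows "tail_exponent \<alpha> \<beta> x \<le> 2 * beta_rate \<alpha> \<beta> x"
proof -
  define s where "s = \<alpha> + \<beta>"
  have s: "s > 0" "\<alpha> \<le> s" "\<beta> \<le> s" using ab by (auto simp: s_def)
  have sx: "s * x \<le> \<beta>" using x s by (simp add: s_def pos_le_divide_eq mult.commute)
  have R: "beta_rate \<alpha> \<beta> x = s ^ 3 * x\<^sup>2 / (\<beta> * (\<alpha> + s * x))"
    unfolding s_def by (rule beta_rate_eq[OF ab])
  have sxp: "s * x > 0" using s x by simp
  consider "\<beta> > \<alpha>" "s * x \<le> \<alpha>" | "\<beta> > \<alpha>" "s * x > \<alpha>" | "\<beta> \<le> \<alpha>" by linarith
  then show ?thesis
  proof cases
    case 1
    have "\<beta>\<^sup>2 * x\<^sup>2 / \<alpha> = 2 * (\<beta> ^ 3 * x\<^sup>2 / (\<beta> * (\<alpha> + \<alpha>)))"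
      using ab by (simp add: power3_eq_cube power2_eq_square)
    also have "\<dots> \<le> 2 * (s ^ 3 * x\<^sup>2 / (\<beta> * (\<alpha> + s * x)))"
      using 1 ab s sxp by (intro mult_left_mono frac_le mult_right_mono power_mono mult_pos_pos) auto
    finally show ?thesis using 1 R by (simp add: tail_exponent_def)
  next
    case 2
    have "\<beta> * x = \<beta>\<^sup>2 * s * x\<^sup>2 / (\<beta> * (s * x))"
      using ab s x by (simp add: power2_eq_square)
    also have "\<dots> \<le> s\<^sup>2 * s * x\<^sup>2 / (\<beta> * (s * x))"
      using ab s x by (intro divide_right_mono mult_right_mono power_mono) auto
    also have "\<dots> = 2 * (s ^ 3 * x\<^sup>2 / (\<beta> * (s * x + s * x)))"
      by (simp add: power3_eq_cube power2_eq_square)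
    also have "\<dots> \<le> 2 * (s ^ 3 * x\<^sup>2 / (\<beta> * (\<alpha> + s * x)))"
      using 2 ab s sxp by (intro mult_left_mono divide_left_mono mult_pos_pos) auto
    finally show ?thesis using 2 R by (simp add: tail_exponent_def)
  next
    case 3
    have "\<alpha>\<^sup>2 * x\<^sup>2 / \<beta> \<le> s\<^sup>2 * x\<^sup>2 / \<beta>"
      using ab s by (intro divide_right_mono mult_right_mono power_mono) auto
    also have "\<dots> = s ^ 3 * x\<^sup>2 / (\<beta> * s)"
      using s by (simp add: power3_eq_cube power2_eq_square)
    also have "\<dots> \<le> s ^ 3 * x\<^sup>2 / (\<beta> * (\<alpha> + s * x))"
      using ab s sx sxp by (intro divide_left_mono mult_left_mono mult_pos_pos) (auto simp: s_def)
    finally have "\<alpha>\<^sup>2 * x\<^sup>2 / \<beta> \<le> beta_rate \<alpha> \<beta> x" using R by simp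
    moreover have "beta_rate \<alpha> \<beta> x \<ge> 0" unfolding R using ab sxp s by simp
    ultimately show ?thesis using 3 by (simp add: tail_exponent_def)
  qed
qed

text \<open>Far from the mean the exponent is bounded away from \<open>0\<close>. This is what allows a bad constant
  in front of the exponential to be traded for a larger constant inside it.\<close>
lemma beta_rate_ge_quarter:
  assumes ab: "\<alpha> \<ge> 1" "\<beta> \<ge> 1"
    and x: "(1 - \<alpha> / (\<alpha> + \<beta>)) / 2 \<le> x" "x \<le> 1 - \<alpha> / (\<alpha> + \<beta>)"
  shows "beta_rate \<alpha> \<beta> x \<ge> 1 / 4"
proof -
  define m where "m = \<alpha> / (\<alpha> + \<beta>)"
  have m: "0 < m" "m < 1" using ab by (auto simp: m_def)
  have x': "(1 - m) / 2 \<le> x" "m + x \<le> 1" using x by (auto simp: m_def)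
  have sm: "(\<alpha> + \<beta>) * (1 - m) = \<beta>" using ab by (simp add: m_def field_simps)
  have "1 / 4 \<le> (\<alpha> + \<beta>) * (1 - m) / 4" using ab sm by simp
  also have "\<dots> = (\<alpha> + \<beta>) * ((1 - m) / 2)\<^sup>2 / ((1 - m) * 1)"
    using m by (simp add: power2_eq_square field_simps)
  also have "\<dots> \<le> (\<alpha> + \<beta>) * x\<^sup>2 / ((1 - m) * (m + x))"
    using m x' ab by (intro frac_le mult_left_mono power_mono mult_pos_pos) auto
  finally show ?thesis by (simp add: beta_rate_def m_def)
qed

section \<open>Tail bounds with explicit constants\<close>

lemma beta_upper_tail_upper_bound:
  assumes ab: "\<alpha> > 0" "\<beta> > 0" and x: "0 < x" "x < \<beta> / (\<alpha> + \<beta>)"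
  shows "measure (beta_distribution \<alpha> \<beta>) {\<alpha> / (\<alpha> + \<beta>) + x..}
    \<le> 2 * exp (- (1 / 4) * tail_exponent \<alpha> \<beta> x)"
proof -
  have "measure (beta_distribution \<alpha> \<beta>) {\<alpha> / (\<alpha> + \<beta>) + x..} \<le> exp (- beta_rate \<alpha> \<beta> x / 2)"
    using x by (intro beta_upper_tail_le ab) auto
  also have "\<dots> \<le> exp (- (1 / 4) * tail_exponent \<alpha> \<beta> x)"
    using tail_exponent_le_beta_rate[OF ab, of x] x by simp
  also have "\<dots> \<le> 2 * exp (- (1 / 4) * tail_exponent \<alpha> \<beta> x)" by simp
  finally show ?thesis .
qed

text \<open>The constant in front of the exponential must not depend on \<open>\<eta>\<close>, although the one in
  \<open>beta_upper_tail_ge\<close> does through \<open>k\<close>. For \<open>x\<close> at most half of \<open>1 - m\<close>, with \<open>m\<close> the mean, that lemma is used with the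
  fixed value \<open>k = 1 / 4\<close>, which gives \<open>exp (- 2) / 288\<close>. For larger \<open>x\<close> the exponent is at least
  \<open>1 / 4\<close>, and the part of the prefactor that depends on \<open>\<eta>\<close> is absorbed into it.\<close>
lemma beta_upper_tail_lower_bound:
  fixes \<eta> :: real
  assumes eta: "\<eta> > 1"
  obtains C where "C > 0"
    "\<And>\<alpha> \<beta> x. \<alpha> \<ge> 1 \<Longrightarrow> \<beta> \<ge> 1 \<Longrightarrow> 0 < x \<Longrightarrow> x \<le> \<beta> / (\<eta> * (\<alpha> + \<beta>)) \<Longrightarrow>
      measure (beta_distribution \<alpha> \<beta>) {\<alpha> / (\<alpha> + \<beta>) + x..}
        \<ge> exp (- 2) / 288 * exp (- C * tail_exponent \<alpha> \<beta> x)"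
proof
  define k where "k = (1 - 1 / \<eta>) / 2"
  have k: "0 < k" "k \<le> 1 / 2" using eta by (auto simp: k_def)
  define c where "c = exp (- 2 :: real) / 288"
  define K where "K = k / 72 * exp (- 1 / (2 * k))"
  \<comment> \<open>\<open>exp (- L)\<close> is the loss in the prefactor; the exponent is at least \<open>1 / 4\<close> when it
    occurs, so adding \<open>4 * L\<close> to the constant pays for it.\<close>
  define L where "L = max 0 (ln (c / K))"
  have cK: "c > 0" "K > 0" using k by (auto simp: c_def K_def)
  have L: "L \<ge> 0" "c * exp (- L) \<le> K"
  proof -
    have "c / K = exp (ln (c / K))" using cK by simp
    also have "\<dots> \<le> exp L" by (simp add: L_def)
    finally show "c * exp (- L) \<le> K" using cK by (simp add: exp_minus field_simps)
  qed (simp add: L_def)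
  define C' where "C' = 32 + 8 / k + 4 * L"
  have C': "C' > 0" using k L by (simp add: C'_def add_pos_nonneg)
  then show "8 * C' > 0" by simp
  fix \<alpha> \<beta> x :: real
  assume ab: "\<alpha> \<ge> 1" "\<beta> \<ge> 1" and x: "0 < x" "x \<le> \<beta> / (\<eta> * (\<alpha> + \<beta>))"
  have ab0: "\<alpha> > 0" "\<beta> > 0" using ab by auto
  define m where "m = \<alpha> / (\<alpha> + \<beta>)"
  have m: "0 < m" "m < 1" using ab by (auto simp: m_def)
  have "\<beta> / (\<eta> * (\<alpha> + \<beta>)) = (1 - m) / \<eta>"
    using ab eta by (simp add: m_def field_simps)
  then have xm: "x \<le> (1 - m) / \<eta>" using x by simp
  have k2: "2 * k * (1 - m) = (1 - m) - (1 - m) / \<eta>" using eta by (simp add: k_def field_simps)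
  define R where "R = beta_rate \<alpha> \<beta> x"
  have R8: "R \<le> 8 * tail_exponent \<alpha> \<beta> x"
    unfolding R_def by (rule beta_rate_le_tail_exponent[OF ab0 x(1)])
  have R0: "R \<ge> 0" unfolding R_def beta_rate_def using m x ab by (simp add: m_def)
  have "c * exp (- (8 * C') * tail_exponent \<alpha> \<beta> x) \<le> c * exp (- (C' * R))"
    using mult_left_mono[OF R8, of C'] C' cK by (intro mult_left_mono) auto
  also have "\<dots> \<le> measure (beta_distribution \<alpha> \<beta>) {m + x..}"
  proof (cases "x \<le> (1 - m) / 2")
    case True
    have "32 * R \<le> C' * R" using R0 k L by (intro mult_right_mono) (auto simp: C'_def)
    then have "c * exp (- (C' * R)) \<le> c * exp (- 32 * R)" using cK by simp
    also have "\<dots> = (1 / 4) / 72 * exp (- 1 / (2 * (1 / 4))) * exp (- (8 / (1 / 4)) * R)"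
      by (simp add: c_def)
    also have "\<dots> \<le> measure (beta_distribution \<alpha> \<beta>) {m + x..}"
      unfolding R_def m_def by (rule beta_upper_tail_ge[OF ab]) (use x True in \<open>auto simp: m_def field_simps\<close>)
    finally show ?thesis .
  next
    case False
    have "(1 - m) / \<eta> \<le> (1 - m) / 1" using m eta by (intro divide_left_mono) auto
    then have "R \<ge> 1 / 4"
      unfolding R_def using False xm by (intro beta_rate_ge_quarter ab) (auto simp: m_def)
    then have "L \<le> 4 * L * R" using mult_left_mono[of "1/4" R "4 * L"] L by simp
    then have "L + 8 / k * R \<le> C' * R" using R0 by (simp add: C'_def distrib_right)
    then have "c * exp (- (C' * R)) \<le> c * exp (- L + - (8 / k) * R)" using cK by simp
    also have "\<dots> = c * exp (- L) * exp (- (8 / k) * R)" by (simp only: exp_add mult.assoc)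
    also have "\<dots> \<le> K * exp (- (8 / k) * R)" using L by (intro mult_right_mono) auto
    also have "\<dots> \<le> measure (beta_distribution \<alpha> \<beta>) {m + x..}"
      unfolding R_def m_def K_def
      by (rule beta_upper_tail_ge[OF ab]) (use x xm k k2 in \<open>auto simp: m_def\<close>)
    finally show ?thesis .
  qed
  finally show "exp (- 2) / 288 * exp (- (8 * C') * tail_exponent \<alpha> \<beta> x)
      \<le> measure (beta_distribution \<alpha> \<beta>) {\<alpha> / (\<alpha> + \<beta>) + x..}"
    by (simp add: c_def m_def)
qed

lemma beta_lower_tail_below_mean:
  assumes "\<alpha> > 0" "\<beta> > 0"
  shows "measure (beta_distribution \<alpha> \<beta>) {..\<alpha> / (\<alpha> + \<beta>) - x}
    = measure (beta_distribution \<beta> \<alpha>) {\<beta> / (\<beta> + \<alpha>) + x..}"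
proof -
  have "1 - (\<alpha> / (\<alpha> + \<beta>) - x) = \<beta> / (\<beta> + \<alpha>) + x" using assms by (simp add: field_simps)
  then show ?thesis by (simp only: beta_lower_tail_reflect[OF assms])
qed

lemma if_exp_tail_exponent:
  "(if \<beta> > \<alpha> then A * exp (B * min (\<beta>\<^sup>2 * x\<^sup>2 / \<alpha>) (\<beta> * x)) else A * exp (B * (\<alpha>\<^sup>2 * x\<^sup>2 / \<beta>)))
    = A * exp (B * tail_exponent \<alpha> \<beta> x)"
  by (simp add: tail_exponent_def)

theorem theorem8:
  shows
    "(\<exists>c::real. c > 0 \<and> (\<forall>\<alpha> \<beta> :: real. \<alpha> \<ge> 1 \<and> \<beta> \<ge> 1 \<longrightarrow>
        (\<forall>x. 0 < x \<and> x < \<beta> / (\<alpha> + \<beta>) \<longrightarrow>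
          \<P>(Z in beta_distribution \<alpha> \<beta>. Z \<ge> \<alpha> / (\<alpha> + \<beta>) + x)
            \<le> (if \<beta> > \<alpha> then 2 * exp (- c * min (\<beta>\<^sup>2 * x\<^sup>2 / \<alpha>) (\<beta> * x))
                else 2 * exp (- c * (\<alpha>\<^sup>2 * x\<^sup>2 / \<beta>)))) \<and>
        (\<forall>x. 0 < x \<and> x < \<alpha> / (\<alpha> + \<beta>) \<longrightarrow>
          \<P>(Z in beta_distribution \<alpha> \<beta>. Z \<le> \<alpha> / (\<alpha> + \<beta>) - x)
            \<le> (if \<alpha> > \<beta> then 2 * exp (- c * min (\<alpha>\<^sup>2 * x\<^sup>2 / \<beta>) (\<alpha> * x))
                else 2 * exp (- c * (\<beta>\<^sup>2 * x\<^sup>2 / \<alpha>))))))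
   \<and> (\<exists>c::real. c > 0 \<and> (\<forall>\<eta>::real. \<eta> > 1 \<longrightarrow> (\<exists>C::real. C > 0 \<and>
        (\<forall>\<alpha> \<beta> :: real. \<alpha> \<ge> 1 \<and> \<beta> \<ge> 1 \<longrightarrow>
          (\<forall>x. 0 < x \<and> x \<le> \<beta> / (\<eta> * (\<alpha> + \<beta>)) \<longrightarrow>
            \<P>(Z in beta_distribution \<alpha> \<beta>. Z \<ge> \<alpha> / (\<alpha> + \<beta>) + x)
              \<ge> (if \<beta> > \<alpha> then c * exp (- C * min (\<beta>\<^sup>2 * x\<^sup>2 / \<alpha>) (\<beta> * x))
                  else c * exp (- C * (\<alpha>\<^sup>2 * x\<^sup>2 / \<beta>)))) \<and>
          (\<forall>x. 0 < x \<and> x \<le> \<alpha> / (\<eta> * (\<alpha> + \<beta>)) \<longrightarrow>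
            \<P>(Z in beta_distribution \<alpha> \<beta>. Z \<le> \<alpha> / (\<alpha> + \<beta>) - x)
              \<ge> (if \<alpha> > \<beta> then c * exp (- C * min (\<alpha>\<^sup>2 * x\<^sup>2 / \<beta>) (\<alpha> * x))
                  else c * exp (- C * (\<beta>\<^sup>2 * x\<^sup>2 / \<alpha>))))))))
   \<and> (\<forall>\<alpha> \<beta> :: real. \<alpha> \<ge> 1 \<and> \<beta> \<ge> 1 \<longrightarrow>
        (\<forall>x. x > \<beta> / (\<alpha> + \<beta>) \<longrightarrow>
          \<P>(Z in beta_distribution \<alpha> \<beta>. Z \<ge> \<alpha> / (\<alpha> + \<beta>) + x) = 0) \<and>
        (\<forall>x. x > \<alpha> / (\<alpha> + \<beta>) \<longrightarrow>
          \<P>(Z in beta_distribution \<alpha> \<beta>. Z \<le> \<alpha> / (\<alpha> + \<beta>) - x) = 0))"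
proof -
  have up: "\<P>(Z in beta_distribution \<alpha> \<beta>. Z \<ge> t) = measure (beta_distribution \<alpha> \<beta>) {t..}" for \<alpha> \<beta> t
    by (simp add: atLeast_def)
  have down: "\<P>(Z in beta_distribution \<alpha> \<beta>. Z \<le> \<alpha> / (\<alpha> + \<beta>) - x)
      = measure (beta_distribution \<beta> \<alpha>) {\<beta> / (\<beta> + \<alpha>) + x..}" if "\<alpha> \<ge> 1 \<and> \<beta> \<ge> 1" for \<alpha> \<beta> x
    using beta_lower_tail_below_mean[of \<alpha> \<beta> x] that by (simp add: atMost_def)
  have mean: "\<alpha> / (\<alpha> + \<beta>) + \<beta> / (\<alpha> + \<beta>) = 1" if "\<alpha> \<ge> 1 \<and> \<beta> \<ge> 1" for \<alpha> \<beta> :: real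
    using that by (simp add: add_divide_distrib[symmetric])
  show ?thesis
    unfolding if_exp_tail_exponent
  proof (intro conjI)
    show "\<exists>c::real. c > 0 \<and> (\<forall>\<alpha> \<beta> :: real. \<alpha> \<ge> 1 \<and> \<beta> \<ge> 1 \<longrightarrow>
        (\<forall>x. 0 < x \<and> x < \<beta> / (\<alpha> + \<beta>) \<longrightarrow>
          \<P>(Z in beta_distribution \<alpha> \<beta>. Z \<ge> \<alpha> / (\<alpha> + \<beta>) + x) \<le> 2 * exp (- c * tail_exponent \<alpha> \<beta> x)) \<and>
        (\<forall>x. 0 < x \<and> x < \<alpha> / (\<alpha> + \<beta>) \<longrightarrow>
          \<P>(Z in beta_distribution \<alpha> \<beta>. Z \<le> \<alpha> / (\<alpha> + \<beta>) - x) \<le> 2 * exp (- c * tail_exponent \<beta> \<alpha> x)))"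
    proof (intro exI[of _ "1 / 4"] conjI allI impI, goal_cases)
      case (2 \<alpha> \<beta> x)
      then show ?case unfolding up by (intro beta_upper_tail_upper_bound) auto
    next
      case (3 \<alpha> \<beta> x)
      then show ?case unfolding down[OF 3(1)]
        by (intro beta_upper_tail_upper_bound) (auto simp: add.commute)
    qed simp
    show "\<exists>c::real. c > 0 \<and> (\<forall>\<eta>::real. \<eta> > 1 \<longrightarrow> (\<exists>C::real. C > 0 \<and>
        (\<forall>\<alpha> \<beta> :: real. \<alpha> \<ge> 1 \<and> \<beta> \<ge> 1 \<longrightarrow>
          (\<forall>x. 0 < x \<and> x \<le> \<beta> / (\<eta> * (\<alpha> + \<beta>)) \<longrightarrow>
            \<P>(Z in beta_distribution \<alpha> \<beta>. Z \<ge> \<alpha> / (\<alpha> + \<beta>) + x) \<ge> c * exp (- C * tail_exponent \<alpha> \<beta> x)) \<and>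
          (\<forall>x. 0 < x \<and> x \<le> \<alpha> / (\<eta> * (\<alpha> + \<beta>)) \<longrightarrow>
            \<P>(Z in beta_distribution \<alpha> \<beta>. Z \<le> \<alpha> / (\<alpha> + \<beta>) - x) \<ge> c * exp (- C * tail_exponent \<beta> \<alpha> x)))))"
    proof (rule exI[of _ "exp (- 2) / 288"], intro conjI allI impI)
      fix \<eta> :: real assume "\<eta> > 1"
      then obtain C where C: "C > 0" and
        bound: "\<And>\<alpha> \<beta> x. \<alpha> \<ge> 1 \<Longrightarrow> \<beta> \<ge> 1 \<Longrightarrow> 0 < x \<Longrightarrow> x \<le> \<beta> / (\<eta> * (\<alpha> + \<beta>)) \<Longrightarrow>
          measure (beta_distribution \<alpha> \<beta>) {\<alpha> / (\<alpha> + \<beta>) + x..}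
            \<ge> exp (- 2) / 288 * exp (- C * tail_exponent \<alpha> \<beta> x)"
        by (rule beta_upper_tail_lower_bound) blast
      show "\<exists>C::real. C > 0 \<and>
        (\<forall>\<alpha> \<beta> :: real. \<alpha> \<ge> 1 \<and> \<beta> \<ge> 1 \<longrightarrow>
          (\<forall>x. 0 < x \<and> x \<le> \<beta> / (\<eta> * (\<alpha> + \<beta>)) \<longrightarrow>
            \<P>(Z in beta_distribution \<alpha> \<beta>. Z \<ge> \<alpha> / (\<alpha> + \<beta>) + x)
              \<ge> exp (- 2) / 288 * exp (- C * tail_exponent \<alpha> \<beta> x)) \<and>
          (\<forall>x. 0 < x \<and> x \<le> \<alpha> / (\<eta> * (\<alpha> + \<beta>)) \<longrightarrow>
            \<P>(Z in beta_distribution \<alpha> \<beta>. Z \<le> \<alpha> / (\<alpha> + \<beta>) - x)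
              \<ge> exp (- 2) / 288 * exp (- C * tail_exponent \<beta> \<alpha> x)))"
      proof (intro exI[of _ C] conjI allI impI C, goal_cases)
        case (1 \<alpha> \<beta> x)
        then show ?case unfolding up by (intro bound) auto
      next
        case (2 \<alpha> \<beta> x)
        then show ?case unfolding down[OF 2(1)] by (intro bound) (auto simp: add.commute)
      qed
    qed simp
    show "\<forall>\<alpha> \<beta> :: real. \<alpha> \<ge> 1 \<and> \<beta> \<ge> 1 \<longrightarrow>
        (\<forall>x. x > \<beta> / (\<alpha> + \<beta>) \<longrightarrow>
          \<P>(Z in beta_distribution \<alpha> \<beta>. Z \<ge> \<alpha> / (\<alpha> + \<beta>) + x) = 0) \<and>
        (\<forall>x. x > \<alpha> / (\<alpha> + \<beta>) \<longrightarrow>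
          \<P>(Z in beta_distribution \<alpha> \<beta>. Z \<le> \<alpha> / (\<alpha> + \<beta>) - x) = 0)"
    proof (intro conjI allI impI, goal_cases)
      case (1 \<alpha> \<beta> x)
      then show ?case unfolding up using mean[OF 1(1)] by (intro beta_upper_tail_trivial) auto
    next
      case (2 \<alpha> \<beta> x)
      then show ?case unfolding down[OF 2(1)] using mean[OF 2(1)]
        by (intro beta_upper_tail_trivial) (auto simp: add.commute)
    qed
  qed
qed

end
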